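(* Let $\lVert\cdot\rVert_A$ be a rearrangement-invariant quasi-Banach function norm over $([0,\infty),\lambda)$, with corresponding space $A$. Then (1) $WL(L^\infty,A)\hookrightarrow A$; (2) if $\lVert\cdot\rVert_A$ has the property (P1), then $WL(A,L^1)\hookrightarrow A$; (3) $A\hookrightarrow WL(L^1,A)$ if and only if $\lVert\cdot\rVert_A$ has the property (P5); (4) $A\hookrightarrow WL(A,L^\infty)$.
   Context: $\lambda$ is Lebesgue measure on $[0,\infty)$; $M$ is the set of extended complex-valued $\lambda$-measurable functions on $[0,\infty)$ (identified when equal a.e.), $M_+$ the non-negative ones. The non-increasing rearrangement of $f\in M$ is $f^*(t)=\inf\{s\ge 0:\lambda(\{|f|>s\})\le t\}$. $L^1,L^\infty$ are the Lebesgue spaces over $([0,\infty),\lambda)$. A quasi-Banach function norm is a map $\lVert\cdot\rVert:M\to[0,\infty]$ with $\lVert\,|f|\,\rVert=\lVert f\rVert$ whose restriction to $M_+$ satisfies: (Q1) it is positively homogeneous, $\lVert f\rVert=0\Leftrightarrow f=0$ a.e., and there is a constant $C\ge1$ with $\lVert f+g\rVert\le C(\lVert f\rVert+\lVert g\rVert)$; (P2) $f\le g$ a.e. implies $\lVert f\rVert\le\lVert g\rVert$; (P3) $f_n\uparrow f$ a.e. implies $\lVert f_n\rVert\uparrow\lVert f\rVert$; (P4) $\lVert\chi_E\rVert<\infty$ whenever $\lambda(E)<\infty$. Property (P1): (Q1) holds with $C=1$. Property (P5): for every $E$ with $\lambda(E)<\infty$ there is a finite $C_E$ with $\int_E f\,d\lambda\le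 C_E\lVert f\rVert$ for all $f\in M_+$. The norm is rearrangement-invariant (r.i.) if $f^*=g^*$ implies $\lVert f\rVert=\lVert g\rVert$. The corresponding space is $X=\{f\in M:\lVert f\rVert_X<\infty\}$. For r.i. quasi-Banach function norms: $\lVert f\rVert_{WL(A,B)}=\lVert f^*\chi_{[0,1]}\rVert_A+\lVert f^*\chi_{(1,\infty)}\rVert_B$ for $f\in M$, and $WL(A,B)=\{f\in M:\lVert f\rVert_{WL(A,B)}<\infty\}$. $Y\hookrightarrow X$ means $Y\subseteq X$ and the identity $Y\to X$ is continuous, i.e. $\lVert f\rVert_X\le K\lVert f\rVert_Y$ for all $f\in Y$ with some finite constant $K$. *)

theory Defs
  imports "HOL-Probability.Essential_Supremum"
begin

abbreviation halfline :: "real measure" where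
  "halfline \<equiv> lebesgue_on {0..}"

text \<open>The extended complex numbers are the one-point compactification of the complex plane:
  \<open>None\<close> is the point at infinity. Since only moduli are ever added or multiplied by constants,
  no arithmetic on this type is needed.\<close>

type_synonym ecomplex = "complex option"

definition ecomplex_borel :: "ecomplex measure" where
  "ecomplex_borel = sigma UNIV {U. openin (Alexandroff_compactification euclidean) U}"

definition emod :: "ecomplex \<Rightarrow> ennreal" where
  "emod z = (case z of None \<Rightarrow> \<infinity> | Some w \<Rightarrow> ennreal (cmod w))"

definition ecomplex_of_ennreal :: "ennreal \<Rightarrow> ecomplex" where
  "ecomplex_of_ennreal x = (if x = \<infinity> then None else Some (complex_of_real (enn2real x)))"

text \<open>\<open>M_plus\<close> consists of \<open>ennreal\<close>-valued functions; \<open>emb\<close> is the inclusion into \<open>M_all\<close>.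
  Functions are not quotiented by equality a.e., and their values outside the half-line are
  irrelevant: every function norm below is automatically invariant under equality a.e.
  on the half-line; see \<open>quasi_banach_norm_cong_AE\<close>.\<close>

definition M_all :: "(real \<Rightarrow> ecomplex) set" where
  "M_all = measurable halfline ecomplex_borel"

definition M_plus :: "(real \<Rightarrow> ennreal) set" where
  "M_plus = borel_measurable halfline"

definition emb :: "(real \<Rightarrow> ennreal) \<Rightarrow> real \<Rightarrow> ecomplex" where
  "emb u = (\<lambda>x. ecomplex_of_ennreal (u x))"

definition fabs :: "(real \<Rightarrow> ecomplex) \<Rightarrow> real \<Rightarrow> ennreal" where
  "fabs f = (\<lambda>x. emod (f x))"

text \<open>Only the values at \<open>t \<ge> 0\<close> are meaningful.\<close>

definition rearr :: "(real \<Rightarrow> ecomplex) \<Rightarrow> real \<Rightarrow> ennreal" where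
  "rearr f t =
     Inf {ennreal s | s. 0 \<le> s \<and>
            emeasure halfline {x \<in> space halfline. fabs f x > ennreal s} \<le> ennreal t}"

type_synonym fnorm = "(real \<Rightarrow> ecomplex) \<Rightarrow> ennreal"

definition prop_Q1 :: "real \<Rightarrow> fnorm \<Rightarrow> bool" where
  "prop_Q1 C N \<longleftrightarrow>
     (\<forall>a\<ge>0. \<forall>u\<in>M_plus. N (emb (\<lambda>x. ennreal a * u x)) = ennreal a * N (emb u)) \<and>
     (\<forall>u\<in>M_plus. N (emb u) = 0 \<longleftrightarrow> (AE x in halfline. u x = 0)) \<and>
     (\<forall>u\<in>M_plus. \<forall>v\<in>M_plus.
        N (emb (\<lambda>x. u x + v x)) \<le> ennreal C * (N (emb u) + N (emb v)))"

definition prop_P1 :: "fnorm \<Rightarrow> bool" where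
  "prop_P1 N \<longleftrightarrow> prop_Q1 1 N"

definition prop_P2 :: "fnorm \<Rightarrow> bool" where
  "prop_P2 N \<longleftrightarrow>
     (\<forall>u\<in>M_plus. \<forall>v\<in>M_plus. (AE x in halfline. u x \<le> v x) \<longrightarrow> N (emb u) \<le> N (emb v))"

definition prop_P3 :: "fnorm \<Rightarrow> bool" where
  "prop_P3 N \<longleftrightarrow>
     (\<forall>U u. (\<forall>n::nat. U n \<in> M_plus) \<longrightarrow> u \<in> M_plus \<longrightarrow>
        (AE x in halfline. incseq (\<lambda>n. U n x) \<and> (\<lambda>n. U n x) \<longlonglongrightarrow> u x) \<longrightarrow>
        incseq (\<lambda>n. N (emb (U n))) \<and> (\<lambda>n. N (emb (U n))) \<longlonglongrightarrow> N (emb u))"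

definition prop_P4 :: "fnorm \<Rightarrow> bool" where
  "prop_P4 N \<longleftrightarrow>
     (\<forall>E\<in>sets halfline. emeasure halfline E < \<infinity> \<longrightarrow> N (emb (indicator E)) < \<infinity>)"

definition prop_P5 :: "fnorm \<Rightarrow> bool" where
  "prop_P5 N \<longleftrightarrow>
     (\<forall>E\<in>sets halfline. emeasure halfline E < \<infinity> \<longrightarrow>
        (\<exists>C\<ge>0. \<forall>u\<in>M_plus. (\<integral>\<^sup>+x\<in>E. u x \<partial>halfline) \<le> ennreal C * N (emb u)))"

definition quasi_banach_norm :: "fnorm \<Rightarrow> bool" where
  "quasi_banach_norm N \<longleftrightarrow>
     (\<forall>f\<in>M_all. N (emb (fabs f)) = N f) \<and>
     (\<exists>C\<ge>1. prop_Q1 C N) \<and> prop_P2 N \<and> prop_P3 N \<and> prop_P4 N"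

definition rearrangement_invariant :: "fnorm \<Rightarrow> bool" where
  "rearrangement_invariant N \<longleftrightarrow>
     (\<forall>f\<in>M_all. \<forall>g\<in>M_all. (\<forall>t\<ge>0. rearr f t = rearr g t) \<longrightarrow> N f = N g)"

definition fspace :: "fnorm \<Rightarrow> (real \<Rightarrow> ecomplex) set" where
  "fspace N = {f \<in> M_all. N f < \<infinity>}"

definition embeds :: "fnorm \<Rightarrow> fnorm \<Rightarrow> bool" (infix "\<hookrightarrow>" 50) where
  "NY \<hookrightarrow> NX \<longleftrightarrow>
     fspace NY \<subseteq> fspace NX \<and> (\<exists>K\<ge>0. \<forall>f\<in>fspace NY. NX f \<le> ennreal K * NY f)"

definition L1 :: fnorm where
  "L1 f = (\<integral>\<^sup>+x. fabs f x \<partial>halfline)"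

definition Linf :: fnorm where
  "Linf f = esssup halfline (fabs f)"

definition WL :: "fnorm \<Rightarrow> fnorm \<Rightarrow> fnorm" where
  "WL NA NB f =
     NA (emb (\<lambda>t. rearr f t * indicator {0..1} t)) +
     NB (emb (\<lambda>t. rearr f t * indicator {1<..} t))"

lemma emod_of_ennreal [simp]: "emod (ecomplex_of_ennreal x) = x"
  by (cases x) (auto simp: emod_def ecomplex_of_ennreal_def)

lemma fabs_emb [simp]: "fabs (emb u) = u"
  by (simp add: fabs_def emb_def)

lemma emod_measurable: "emod \<in> borel_measurable ecomplex_borel"
proof (rule borel_measurableI_greater)
  fix y :: ennreal
  have "openin (Alexandroff_compactification euclidean) {z. y < emod z}"
  proof (cases y)
    case (real r)
    have "{z. y < emod z} = insert None (Some ` (topspace euclidean - cball 0 r))"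
    proof (rule set_eqI)
      fix z
      show "z \<in> {z. y < emod z} \<longleftrightarrow>
          z \<in> insert None (Some ` (topspace euclidean - cball 0 r))"
        using real by (cases z) (simp_all add: emod_def ennreal_less_iff image_iff not_le)
    qed
    moreover have "compactin euclidean (cball (0::complex) r)"
        "closedin euclidean (cball (0::complex) r)"
      by auto
    ultimately show ?thesis
      unfolding openin_Alexandroff_compactification by blast
  next
    case top
    then show ?thesis by simp
  qed
  then show "{z \<in> space ecomplex_borel. y < emod z} \<in> sets ecomplex_borel"
    by (auto simp: ecomplex_borel_def)
qed

lemma fabs_M_plus: "f \<in> M_all \<Longrightarrow> fabs f \<in> M_plus"
  using measurable_compose[OF _ emod_measurable]
  by (auto simp: M_all_def M_plus_def fabs_def)

lemma ecomplex_of_ennreal_measurable: "ecomplex_of_ennreal \<in> borel \<rightarrow>\<^sub>M ecomplex_borel"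
  unfolding ecomplex_borel_def
proof (rule measurable_measure_of)
  fix V :: "ecomplex set"
  assume "V \<in> {U. openin (Alexandroff_compactification euclidean) U}"
  then consider (fin) U where "open U" "V = Some ` U"
    | (inf) C where "closed C" "V = insert None (Some ` (- C))"
    unfolding mem_Collect_eq openin_Alexandroff_compactification
    by (auto simp: Compl_eq_Diff_UNIV)
  then have "open (Some -` V)"
  proof cases
    case fin
    then have "Some -` V = U" by auto
    with fin show ?thesis by simp
  next
    case inf
    then have "Some -` V = - C" by auto
    with inf show ?thesis by (simp add: open_Compl)
  qed
  then have m: "(\<lambda>x. complex_of_real (enn2real x)) -` (Some -` V) \<in> sets borel"
    using measurable_sets[of "\<lambda>x. complex_of_real (enn2real x)" borel borel "Some -` V"] by (simp add: borel_open)
  have "ecomplex_of_ennreal -` V \<inter> space borel =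
      ((\<lambda>x. complex_of_real (enn2real x)) -` (Some -` V) - {\<infinity>}) \<union>
      (if None \<in> V then {\<infinity>} else {})"
    by (auto simp: ecomplex_of_ennreal_def split: if_splits)
  with m show "ecomplex_of_ennreal -` V \<inter> space borel \<in> sets borel"
    by simp
qed simp_all

lemma emb_M_all: "u \<in> M_plus \<Longrightarrow> emb u \<in> M_all"
  using measurable_compose[OF _ ecomplex_of_ennreal_measurable]
  by (auto simp: M_all_def M_plus_def emb_def)

lemma quasi_banach_norm_cong_AE:
  assumes N: "quasi_banach_norm N" and f: "f \<in> M_all" and g: "g \<in> M_all"
    and fg: "AE x in halfline. f x = g x"
  shows "N f = N g"
proof -
  have "AE x in halfline. fabs f x \<le> fabs g x" "AE x in halfline. fabs g x \<le> fabs f x"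
    using fg by (auto simp: fabs_def elim: AE_mp)
  then have "N (emb (fabs f)) = N (emb (fabs g))"
    using N f g unfolding quasi_banach_norm_def prop_P2_def
    by (blast intro: antisym fabs_M_plus)
  then show ?thesis
    using N f g by (simp add: quasi_banach_norm_def)
qed

end

theory Submission
  imports Defs
begin

text \<open>Since \<open>f\<close> and \<open>f\<^sup>*\<close> are equimeasurable, \<open>\<parallel>f\<parallel>\<^sub>A = \<parallel>f\<^sup>*\<parallel>\<^sub>A\<close>, so every claim concerns non-increasing
  functions. Each one reduces to comparing \<open>f\<^sup>*\<close> with multiples of indicators of unit intervals,
  all of which have the same norm; for (2), \<open>f\<^sup>*\<close> on \<open>(1,\<infinity>)\<close> is dominated by a sum of such steps
  of heights \<open>f\<^sup>*(1), f\<^sup>*(2), \<dots>\<close>, and \<open>f\<^sup>*(2) + f\<^sup>*(3) + \<dots>\<close> is at most the integral of \<open>f\<^sup>*\<close> over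
  \<open>(1,\<infinity>)\<close>. The forward direction of (3) is the Hardy--Littlewood inequality.\<close>

section \<open>Lebesgue measure on the half-line and the layer-cake formula\<close>

lemma emeasure_halfline_borel:
  assumes "B \<in> sets borel" "B \<subseteq> {0..}"
  shows "emeasure halfline B = emeasure lborel B"
  using assms by (simp add: emeasure_restrict_space)

lemma borel_imp_sets_halfline: "B \<in> sets borel \<Longrightarrow> B \<subseteq> {0..} \<Longrightarrow> B \<in> sets halfline"
  by (simp add: sets_restrict_space_iff)

lemma borel_measurable_halflineI: "u \<in> borel_measurable borel \<Longrightarrow> u \<in> borel_measurable halfline"
  by (simp add: measurable_completion measurable_lborel1 measurable_restrict_space1)

text \<open>The set is \<open>[0, m)\<close>, or the whole half-line for \<open>m = top\<close>.
  Every value in \<open>ennreal\<close> thus becomes the length of an initial segment, which serves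
  both the layer-cake formula and the superlevel sets of \<open>rearr f\<close>.\<close>

lemma emeasure_halfline_below:
  "emeasure halfline {t \<in> space halfline. ennreal t < m} = m"
proof (cases m)
  case (real r)
  then have "{t \<in> space halfline. ennreal t < m} = {0..<r}"
    by (auto simp: ennreal_less_iff)
  with real show ?thesis
    by (simp add: emeasure_halfline_borel subset_eq)
next
  case top
  have "ennreal (real n) \<le> emeasure halfline {0..}" for n
  proof -
    have "ennreal (real n) = emeasure halfline {0..real n}"
      by (simp add: emeasure_halfline_borel)
    also have "\<dots> \<le> emeasure halfline {0..}"
      by (rule emeasure_mono) auto
    finally show ?thesis .
  qed
  then have "emeasure halfline {0..} = top"
    by (metis ennreal_Ex_less_of_nat ennreal_of_nat_eq_real_of_nat leD less_top)
  moreover have "{t \<in> space halfline. ennreal t < m} = {0..}"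
    using top by auto
  ultimately show ?thesis
    using top by simp
qed

lemma sigma_finite_halfline: "sigma_finite_measure halfline"
  unfolding sigma_finite_measure_def
proof (intro exI conjI ballI)
  show "countable (range (\<lambda>n. {0..real n}))" by simp
  show "range (\<lambda>n. {0..real n}) \<subseteq> sets halfline"
    by (auto intro: borel_imp_sets_halfline)
  show "\<Union> (range (\<lambda>n. {0..real n})) = space halfline"
    by (auto intro: real_arch_simple)
qed (auto simp: emeasure_halfline_borel)

text \<open>Tonelli's theorem for the region \<open>0 \<le> s < u x\<close> over \<open>E\<close>:
  its sections in \<open>s\<close> have length \<open>u x\<close>, its sections in \<open>x\<close>
  are superlevel sets.\<close>

lemma set_nn_integral_layer_cake:
  assumes u[measurable]: "u \<in> borel_measurable halfline" and E[measurable]: "E \<in> sets halfline"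
  shows "(\<integral>\<^sup>+x\<in>E. u x \<partial>halfline) =
    (\<integral>\<^sup>+s. emeasure halfline {x \<in> E. ennreal s < u x} \<partial>halfline)"
proof -
  interpret sigma_finite_measure halfline by (rule sigma_finite_halfline)
  interpret P: pair_sigma_finite halfline halfline ..
  have EH: "E \<subseteq> space halfline" by (rule sets.sets_into_space) fact
  have [measurable]: "ennreal \<in> borel_measurable halfline"
    by (rule borel_measurable_halflineI) simp
  let ?I = "\<lambda>x s. indicator {p \<in> space (halfline \<Otimes>\<^sub>M halfline). ennreal (snd p) < u (fst p) \<and> fst p \<in> E} (x, s) :: ennreal"
  have "(\<integral>\<^sup>+x\<in>E. u x \<partial>halfline) = (\<integral>\<^sup>+x. \<integral>\<^sup>+s. ?I x s \<partial>halfline \<partial>halfline)"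
  proof (rule nn_integral_cong)
    fix x assume x: "x \<in> space halfline"
    have "(\<integral>\<^sup>+s. ?I x s \<partial>halfline) =
        (\<integral>\<^sup>+s. indicator E x * indicator {s \<in> space halfline. ennreal s < u x} s \<partial>halfline)"
      using x by (intro nn_integral_cong) (auto simp: space_pair_measure split: split_indicator)
    also have "\<dots> = indicator E x * emeasure halfline {s \<in> space halfline. ennreal s < u x}"
      by (rule nn_integral_cmult_indicator) measurable
    finally show "u x * indicator E x = (\<integral>\<^sup>+s. ?I x s \<partial>halfline)"
      unfolding emeasure_halfline_below by (simp add: mult.commute)
  qed
  also have "\<dots> = (\<integral>\<^sup>+s. \<integral>\<^sup>+x. ?I x s \<partial>halfline \<partial>halfline)"
    by (rule P.Fubini'[symmetric]) measurable
  also have "\<dots> = (\<integral>\<^sup>+s. emeasure halfline {x \<in> E. ennreal s < u x} \<partial>halfline)"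
  proof (rule nn_integral_cong)
    fix s assume s: "s \<in> space halfline"
    have *: "{x \<in> E. ennreal s < u x} = {x \<in> space halfline. ennreal s < u x \<and> x \<in> E}"
      using EH by auto
    have "(\<integral>\<^sup>+x. ?I x s \<partial>halfline) = (\<integral>\<^sup>+x. indicator {x \<in> E. ennreal s < u x} x \<partial>halfline)"
      using s EH by (intro nn_integral_cong) (auto simp: space_pair_measure split: split_indicator)
    also have "\<dots> = emeasure halfline {x \<in> E. ennreal s < u x}"
      unfolding * by (rule nn_integral_indicator) measurable
    finally show "(\<integral>\<^sup>+x. ?I x s \<partial>halfline) = emeasure halfline {x \<in> E. ennreal s < u x}" .
  qed
  finally show ?thesis .
qed

section \<open>The non-increasing rearrangement: equimeasurability and the Hardy--Littlewood
  inequality\<close>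

text \<open>The distribution function is right-continuous, by continuity of measure from below, so a
  finite infimum in the definition of \<open>rearr\<close> is attained. Hence \<open>rearr f\<close>
  and the distribution function are generalized inverses of each other.\<close>

lemma rearr_le_iff:
  assumes f: "f \<in> M_all" and s: "0 \<le> s"
  shows "rearr f t \<le> ennreal s \<longleftrightarrow>
    emeasure halfline {x \<in> space halfline. ennreal s < fabs f x} \<le> ennreal t"
proof
  assume "emeasure halfline {x \<in> space halfline. ennreal s < fabs f x} \<le> ennreal t"
  with s show "rearr f t \<le> ennreal s"
    unfolding rearr_def by (intro Inf_lower) auto
next
  assume le: "rearr f t \<le> ennreal s"
  have [measurable]: "fabs f \<in> borel_measurable halfline"
    using fabs_M_plus[OF f] by (simp add: M_plus_def)
  \<comment> \<open>Each level slightly above \<open>s\<close> exceeds the infimum strictly, so some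
    admissible level lies below it; the sets \<open>S n\<close> increase to the superlevel set at
    \<open>s\<close>.\<close>
  define S where "S n = {x \<in> space halfline. ennreal (s + inverse (real (Suc n))) < fabs f x}" for n
  have S_le: "emeasure halfline (S n) \<le> ennreal t" for n
  proof -
    have "ennreal s < ennreal (s + inverse (real (Suc n)))"
      using s by (simp add: ennreal_less_iff)
    with le have "rearr f t < ennreal (s + inverse (real (Suc n)))"
      by (rule le_less_trans)
    then obtain s' where s': "0 \<le> s'" "ennreal s' < ennreal (s + inverse (real (Suc n)))"
        "emeasure halfline {x \<in> space halfline. ennreal s' < fabs f x} \<le> ennreal t"
      unfolding rearr_def Inf_less_iff by auto
    have "emeasure halfline (S n) \<le> emeasure halfline {x \<in> space halfline. ennreal s' < fabs f x}"
    proof (rule emeasure_mono)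
      show "{x \<in> space halfline. ennreal s' < fabs f x} \<in> sets halfline" by measurable
    qed (use s'(2) in \<open>auto simp: S_def\<close>)
    with s'(3) show ?thesis by simp
  qed
  have "{x \<in> space halfline. ennreal s < fabs f x} = (\<Union>n. S n)"
  proof (intro equalityI subsetI)
    fix x assume x: "x \<in> {x \<in> space halfline. ennreal s < fabs f x}"
    show "x \<in> (\<Union>n. S n)"
    proof (cases "fabs f x")
      case (real r)
      with x s have "0 < r - s" by (simp add: ennreal_less_iff)
      then obtain n where "inverse (real (Suc n)) < r - s"
        using reals_Archimedean by blast
      with x real s show ?thesis
        by (auto simp: S_def ennreal_less_iff simp del: ennreal_plus intro!: exI[of _ n])
    next
      case top
      with x show ?thesis by (auto simp: S_def)
    qed
  next
    fix x assume "x \<in> (\<Union>n. S n)"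
    then obtain n where n: "x \<in> space halfline" "ennreal (s + inverse (real (Suc n))) < fabs f x"
      by (auto simp: S_def)
    have "ennreal s \<le> ennreal (s + inverse (real (Suc n)))"
      by (intro ennreal_leI) simp
    with n show "x \<in> {x \<in> space halfline. ennreal s < fabs f x}"
      by (auto intro: le_less_trans)
  qed
  moreover have "incseq S"
  proof (rule incseq_SucI)
    fix n
    have "ennreal (s + inverse (real (Suc (Suc n)))) \<le> ennreal (s + inverse (real (Suc n)))"
      by (intro ennreal_leI add_left_mono) (simp add: field_simps)
    then show "S n \<subseteq> S (Suc n)"
      by (auto simp: S_def intro: le_less_trans)
  qed
  moreover have "S n \<in> sets halfline" for n
    unfolding S_def by measurable
  then have "range S \<subseteq> sets halfline" by blast
  ultimately have "emeasure halfline {x \<in> space halfline. ennreal s < fabs f x} =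
      (SUP n. emeasure halfline (S n))"
    by (metis SUP_emeasure_incseq)
  then show "emeasure halfline {x \<in> space halfline. ennreal s < fabs f x} \<le> ennreal t"
    using S_le by (simp add: SUP_least)
qed

lemma rearr_antimono: "s \<le> t \<Longrightarrow> rearr f t \<le> rearr f s"
  unfolding rearr_def by (intro Inf_superset_mono Collect_mono) (blast intro: order_trans ennreal_leI)

text \<open>The superlevel sets of a monotone function are intervals.\<close>

lemma rearr_measurable [measurable]: "rearr f \<in> borel_measurable halfline"
proof (rule borel_measurable_halflineI, rule borel_measurableI_greater)
  fix y
  have "is_interval {t. y < rearr f t}"
    unfolding is_interval_1 by (auto intro: less_le_trans rearr_antimono)
  then show "{t \<in> space borel. y < rearr f t} \<in> sets borel"
    by (simp add: real_interval_borel_measurable)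
qed

lemma rearr_M_plus: "rearr f \<in> M_plus"
  by (simp add: M_plus_def rearr_measurable)

text \<open>By the negation of \<open>rearr_le_iff\<close>, the superlevel set of
  \<open>rearr f\<close> is an initial segment whose length is the measure on the right.\<close>

lemma emeasure_rearr_above:
  assumes "f \<in> M_all" "0 \<le> s"
  shows "emeasure halfline {t \<in> space halfline. ennreal s < rearr f t} =
    emeasure halfline {x \<in> space halfline. ennreal s < fabs f x}"
proof -
  have "{t \<in> space halfline. ennreal s < rearr f t} =
      {t \<in> space halfline. ennreal t < emeasure halfline {x \<in> space halfline. ennreal s < fabs f x}}"
    using rearr_le_iff[OF assms] by (auto simp: not_le[symmetric])
  then show ?thesis
    by (simp only: emeasure_halfline_below)
qed

text \<open>The definition of \<open>rearr\<close> sees a function only through its distribution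
  function.\<close>

lemma rearr_eqI:
  assumes h: "\<And>s. 0 \<le> s \<Longrightarrow>
    emeasure halfline {x \<in> space halfline. ennreal s < fabs f x} =
    emeasure halfline {x \<in> space halfline. ennreal s < fabs g x}"
  shows "rearr f t = rearr g t"
proof -
  have eq: "(0 \<le> s \<and> emeasure halfline {x \<in> space halfline. ennreal s < fabs f x} \<le> ennreal t) =
      (0 \<le> s \<and> emeasure halfline {x \<in> space halfline. ennreal s < fabs g x} \<le> ennreal t)" for s
  proof (rule conj_cong[OF refl])
    assume "0 \<le> s"
    show "(emeasure halfline {x \<in> space halfline. ennreal s < fabs f x} \<le> ennreal t) =
      (emeasure halfline {x \<in> space halfline. ennreal s < fabs g x} \<le> ennreal t)"
      by (subst h[OF \<open>0 \<le> s\<close>]) (rule refl)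
  qed
  show ?thesis
    unfolding rearr_def eq ..
qed

text \<open>Both sides are integrals over levels \<open>s\<close>: on the right, the part of the superlevel set of the
  rearrangement below \<open>\<lambda>(E)\<close> has measure \<open>min \<lambda>(E) \<lambda>(u > s)\<close>.\<close>

lemma set_nn_integral_le_rearr:
  assumes u[measurable]: "u \<in> borel_measurable halfline" and E[measurable]: "E \<in> sets halfline"
  shows "(\<integral>\<^sup>+x\<in>E. u x \<partial>halfline) \<le>
    (\<integral>\<^sup>+t\<in>{t \<in> space halfline. ennreal t < emeasure halfline E}. rearr (emb u) t \<partial>halfline)"
proof -
  let ?F = "{t \<in> space halfline. ennreal t < emeasure halfline E}"
  have EH: "E \<subseteq> space halfline" by (rule sets.sets_into_space) fact
  have [measurable]: "ennreal \<in> borel_measurable halfline"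
    by (rule borel_measurable_halflineI) simp
  have F: "?F \<in> sets halfline" by measurable
  have M: "emb u \<in> M_all" using u by (intro emb_M_all) (simp add: M_plus_def)
  show ?thesis
    unfolding set_nn_integral_layer_cake[OF u E] set_nn_integral_layer_cake[OF rearr_measurable F]
  proof (rule nn_integral_mono)
    fix s assume s: "s \<in> space halfline"
    let ?m = "emeasure halfline {x \<in> space halfline. ennreal s < u x}"
    have "{t \<in> ?F. ennreal s < rearr (emb u) t} =
        {t \<in> space halfline. ennreal t < min (emeasure halfline E) ?m}"
      using rearr_le_iff[OF M, of s] s by (auto simp: not_le[symmetric] min_le_iff_disj)
    then have "emeasure halfline {t \<in> ?F. ennreal s < rearr (emb u) t} = min (emeasure halfline E) ?m"
      by (simp only: emeasure_halfline_below)
    moreover have "emeasure halfline {x \<in> E. ennreal s < u x} \<le> emeasure halfline E"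
      by (intro emeasure_mono) auto
    moreover have "emeasure halfline {x \<in> E. ennreal s < u x} \<le> ?m"
    proof (rule emeasure_mono)
      show "{x \<in> space halfline. ennreal s < u x} \<in> sets halfline" by measurable
    qed (use EH in auto)
    ultimately show "emeasure halfline {x \<in> E. ennreal s < u x} \<le>
        emeasure halfline {t \<in> ?F. ennreal s < rearr (emb u) t}"
      by simp
  qed
qed

section \<open>Embeddings and rearrangement-invariant norms\<close>

text \<open>An inequality on all of \<open>M_all\<close> already yields the inclusion of the spaces,
  as a real multiple of a finite norm is finite.\<close>

lemma embedsI:
  assumes "0 \<le> K" "\<And>f. f \<in> M_all \<Longrightarrow> NX f \<le> ennreal K * NY f"
  shows "NY \<hookrightarrow> NX"
proof -
  have "NX f < \<infinity>" if "f \<in> M_all" "NY f < \<infinity>" for f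
    using assms(2)[OF that(1)] that(2) by (auto intro: le_less_trans simp: ennreal_mult_less_top)
  with assms show ?thesis
    unfolding embeds_def fspace_def by blast
qed

lemma M_plus_mult_indicator:
  assumes "u \<in> M_plus" "E \<in> sets borel"
  shows "(\<lambda>x. u x * indicator E x) \<in> M_plus"
proof -
  have "(indicator E :: real \<Rightarrow> ennreal) \<in> borel_measurable halfline"
    using assms(2) by (intro borel_measurable_halflineI) simp
  with assms(1) show ?thesis by (simp add: M_plus_def)
qed

locale ri_norm =
  fixes A :: fnorm
  assumes norm: "quasi_banach_norm A" and ri: "rearrangement_invariant A"
begin

lemma prop_P2: "prop_P2 A" and prop_P3: "prop_P3 A" and prop_P4: "prop_P4 A"
  using norm by (simp_all only: quasi_banach_norm_def)

lemma prop_Q1: obtains C where "1 \<le> C" "prop_Q1 C A"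
proof -
  have "\<exists>C\<ge>1. prop_Q1 C A"
    using norm by (simp only: quasi_banach_norm_def)
  then show ?thesis using that by blast
qed

lemma A_mono:
  assumes "u \<in> M_plus" "v \<in> M_plus" "AE x in halfline. u x \<le> v x"
  shows "A (emb u) \<le> A (emb v)"
  using prop_P2[unfolded prop_P2_def, rule_format, OF assms] .

lemma A_cmult_real:
  assumes "0 \<le> a" "u \<in> M_plus"
  shows "A (emb (\<lambda>x. ennreal a * u x)) = ennreal a * A (emb u)"
proof -
  obtain C where "prop_Q1 C A" by (rule prop_Q1)
  from this[unfolded prop_Q1_def, THEN conjunct1, rule_format, OF assms] show ?thesis .
qed

lemma A_triangle:
  obtains C where "1 \<le> C"
    "\<And>u v. u \<in> M_plus \<Longrightarrow> v \<in> M_plus \<Longrightarrow>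
      A (emb (\<lambda>x. u x + v x)) \<le> ennreal C * (A (emb u) + A (emb v))"
proof -
  obtain C where C: "1 \<le> C" "prop_Q1 C A" by (rule prop_Q1)
  show ?thesis
    by (rule that[OF C(1) C(2)[unfolded prop_Q1_def, THEN conjunct2, THEN conjunct2, rule_format]])
qed

lemma A_eq_0_imp:
  assumes "u \<in> M_plus" "A (emb u) = 0"
  shows "AE x in halfline. u x = 0"
proof -
  obtain C where "prop_Q1 C A" by (rule prop_Q1)
  from this[unfolded prop_Q1_def, THEN conjunct2, THEN conjunct1, rule_format, OF assms(1)] assms(2)
  show ?thesis by (rule iffD1)
qed

lemma A_limit:
  assumes U: "\<And>n::nat. U n \<in> M_plus" and u: "u \<in> M_plus"
    and lim: "\<And>x. incseq (\<lambda>n. U n x)" "\<And>x. (\<lambda>n. U n x) \<longlonglongrightarrow> u x"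
  shows "(\<lambda>n. A (emb (U n))) \<longlonglongrightarrow> A (emb u)"
proof -
  have "AE x in halfline. incseq (\<lambda>n. U n x) \<and> (\<lambda>n. U n x) \<longlonglongrightarrow> u x"
    by (intro AE_I2 conjI lim)
  from prop_P3[unfolded prop_P3_def, rule_format, OF U u this] show ?thesis ..
qed

text \<open>Homogeneity extends to the scalar \<open>\<infinity>\<close> by (P3), so that \<open>f\<^sup>*(1)\<close> may be infinite below.\<close>

lemma A_cmult:
  assumes u: "u \<in> M_plus"
  shows "A (emb (\<lambda>x. c * u x)) = c * A (emb u)"
proof (cases c)
  case (real a)
  then show ?thesis using A_cmult_real u by simp
next
  case top
  \<comment> \<open>Used twice: pointwise for \<open>u x\<close> and for the value
    \<open>A (emb u)\<close>. The case \<open>b = 0\<close> is separate because multiplication in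
    \<open>ennreal\<close> is discontinuous at \<open>top * 0 = 0\<close>; there the sequence is
    constant.\<close>
  have lim: "(\<lambda>n. of_nat n * b) \<longlonglongrightarrow> top * b" for b :: ennreal
  proof (cases "b = 0")
    case False
    then show ?thesis
      by (intro tendsto_mult_ennreal of_nat_tendsto_top_ennreal tendsto_const) auto
  qed simp
  have "(\<lambda>n. A (emb (\<lambda>x. of_nat n * u x))) \<longlonglongrightarrow> A (emb (\<lambda>x. top * u x))"
    using u lim by (intro A_limit) (auto simp: M_plus_def incseq_def intro: mult_right_mono)
  moreover have "A (emb (\<lambda>x. of_nat n * u x)) = of_nat n * A (emb u)" for n
    using A_cmult_real[of "real n" u] u by (simp add: ennreal_of_nat_eq_real_of_nat)
  ultimately have "(\<lambda>n. of_nat n * A (emb u)) \<longlonglongrightarrow> A (emb (\<lambda>x. top * u x))"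
    by (simp only:)
  then have "A (emb (\<lambda>x. top * u x)) = top * A (emb u)"
    using lim by (rule LIMSEQ_unique)
  with top show ?thesis by simp
qed

lemma A_cong_rearr:
  assumes "f \<in> M_all" "g \<in> M_all" "\<And>t. rearr f t = rearr g t"
  shows "A f = A g"
  by (rule ri[unfolded rearrangement_invariant_def, rule_format]) (rule assms)+

text \<open>By \<open>emeasure_rearr_above\<close> the two functions have the same distribution
  function, so rearranging twice is rearranging once, and invariance applies.\<close>

lemma A_rearr: "f \<in> M_all \<Longrightarrow> A (emb (rearr f)) = A f"
proof -
  assume f: "f \<in> M_all"
  have "rearr (emb (rearr f)) t = rearr f t" for t
    by (rule rearr_eqI) (simp only: fabs_emb emeasure_rearr_above[OF f])
  then show ?thesis
    by (intro A_cong_rearr emb_M_all rearr_M_plus f)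
qed

section \<open>Norms of unit intervals and of pieces of the rearrangement\<close>

text \<open>The exchange rate between a height and the norm of a step of width 1. It is finite by
  (P4) and positive by (Q1), so it may be divided by.\<close>

abbreviation unit_norm :: ennreal where
  "unit_norm \<equiv> A (emb (indicator {0..1}))"

lemma indicator_M_plus: "E \<in> sets borel \<Longrightarrow> indicator E \<in> M_plus"
  by (simp add: M_plus_def borel_measurable_halflineI)

lemma unit_norm_finite: "unit_norm < top"
proof -
  have "{0..1} \<in> sets halfline" by (auto intro: borel_imp_sets_halfline)
  moreover have "emeasure halfline {0..1} < \<infinity>" by (simp add: emeasure_halfline_borel)
  ultimately show ?thesis
    using prop_P4 unfolding prop_P4_def by (metis infinity_ennreal_def)
qed

lemma unit_norm_pos: "0 < unit_norm"
proof (rule ccontr)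
  assume "\<not> 0 < unit_norm"
  then have "AE x in halfline. indicator {0..1} x = (0::ennreal)"
    by (intro A_eq_0_imp indicator_M_plus) auto
  then have "AE x in halfline. x \<notin> {0..1}"
    by (auto elim: AE_mp simp: indicator_def)
  moreover have "{0..1} \<in> sets halfline" by (auto intro: borel_imp_sets_halfline)
  ultimately have "emeasure halfline {0..1} = 0"
    by (subst (asm) AE_iff_measurable[of "{0..1}"]) auto
  then show False by (simp add: emeasure_halfline_borel)
qed

text \<open>Both indicators have superlevel sets of measure 1 at levels below 1 and empty ones from
  1 on. Half-open translates are taken because they tile \<open>(1, \<infinity>)\<close>.\<close>

lemma unit_norm_translate:
  assumes "0 \<le> a"
  shows "A (emb (indicator {a<..a + 1})) = unit_norm"
proof -
  have "rearr (emb (indicator {a<..a + 1})) t = rearr (emb (indicator {0..1})) t" for t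
  proof (rule rearr_eqI)
    fix s :: real assume "0 \<le> s"
    have "{x \<in> space halfline. ennreal s < fabs (emb (indicator E)) x} = (if s < 1 then E else {})"
      if "E \<subseteq> {0..}" for E
      using that \<open>0 \<le> s\<close> by (auto simp: indicator_def ennreal_less_one_iff split: if_splits)
    then show "emeasure halfline {x \<in> space halfline. ennreal s < fabs (emb (indicator {a<..a + 1})) x} =
        emeasure halfline {x \<in> space halfline. ennreal s < fabs (emb (indicator {0..1})) x}"
      using assms by (subst (1 2) \<open>\<And>E. E \<subseteq> {0..} \<Longrightarrow> _\<close>)
        (auto simp: emeasure_halfline_borel subset_iff)
  qed
  then show ?thesis
    by (intro A_cong_rearr emb_M_all indicator_M_plus) auto
qed

text \<open>On \<open>[0, 1]\<close> the rearrangement lies above the constant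
  \<open>rearr f 1\<close>. This is how a point value gets bounded by a norm.\<close>

lemma rearr_1_le: "rearr f 1 * unit_norm \<le> A (emb (\<lambda>t. rearr f t * indicator {0..1} t))"
proof -
  have "rearr f 1 * unit_norm = A (emb (\<lambda>t. rearr f 1 * indicator {0..1} t))"
    by (rule A_cmult[symmetric]) (simp add: indicator_M_plus)
  also have "\<dots> \<le> A (emb (\<lambda>t. rearr f t * indicator {0..1} t))"
    by (intro A_mono M_plus_mult_indicator rearr_M_plus AE_I2)
      (auto simp: M_plus_def split: split_indicator intro: rearr_antimono)
  finally show ?thesis .
qed

lemma A_restrict_le:
  assumes "f \<in> M_all" "E \<in> sets borel"
  shows "A (emb (\<lambda>t. rearr f t * indicator E t)) \<le> A f"
  unfolding A_rearr[OF assms(1), symmetric]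
  using assms(2) by (intro A_mono M_plus_mult_indicator rearr_M_plus AE_I2)
      (auto split: split_indicator)

text \<open>For \<open>t \<ge> 0\<close> exactly one of the two indicators is 1. This form is what
  the triangle inequality applies to.\<close>

lemma A_split:
  assumes f: "f \<in> M_all"
  shows "A f = A (emb (\<lambda>t. rearr f t * indicator {0..1} t + rearr f t * indicator {1<..} t))"
proof -
  let ?v = "\<lambda>t. rearr f t * indicator {0..1} t + rearr f t * indicator {1<..} t"
  have M: "?v \<in> M_plus"
    using M_plus_mult_indicator[OF rearr_M_plus] by (simp add: M_plus_def)
  have "AE t in halfline. rearr f t = ?v t"
    by (rule AE_I2) (auto split: split_indicator)
  then have "A (emb (rearr f)) = A (emb ?v)"
    by (intro antisym A_mono M rearr_M_plus) auto
  with A_rearr[OF f] show ?thesis by simp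
qed

section \<open>The two embeddings that involve \<open>Linf\<close>\<close>

text \<open>On \<open>[0, 1]\<close> the rearrangement is a.e. at most its essential supremum there,
  so this piece costs at most \<open>unit_norm\<close> times that supremum.\<close>

lemma WL_Linf_embeds: "WL Linf A \<hookrightarrow> A"
proof -
  obtain C where C: "1 \<le> C" "\<And>u v. u \<in> M_plus \<Longrightarrow> v \<in> M_plus \<Longrightarrow>
      A (emb (\<lambda>x. u x + v x)) \<le> ennreal C * (A (emb u) + A (emb v))"
    using A_triangle by blast
  obtain p where p: "0 \<le> p" "unit_norm = ennreal p"
    using unit_norm_finite by (cases unit_norm) auto
  show ?thesis
  \<comment> \<open>\<open>C\<close> is the quasi-triangle constant; \<open>p + 1\<close> dominates
    the factor \<open>p\<close> of the bounded piece and the factor 1 of the tail.\<close>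
  proof (rule embedsI[of "C * (p + 1)"])
    fix f assume f: "f \<in> M_all"
    let ?u = "\<lambda>t. rearr f t * indicator {0..1} t" and ?v = "\<lambda>t. rearr f t * indicator {1<..} t"
    have uv: "?u \<in> M_plus" "?v \<in> M_plus"
      by (simp_all add: M_plus_mult_indicator rearr_M_plus)
    have "A (emb ?u) \<le> A (emb (\<lambda>t. Linf (emb ?u) * indicator {0..1} t))"
    proof (rule A_mono[OF uv(1)])
      show "(\<lambda>t. Linf (emb ?u) * indicator {0..1} t) \<in> M_plus"
        by (intro M_plus_mult_indicator) (auto simp: M_plus_def)
      have "AE x in halfline. ?u x \<le> Linf (emb ?u)"
        unfolding Linf_def fabs_emb by (rule esssup_AE)
      then show "AE x in halfline. ?u x \<le> Linf (emb ?u) * indicator {0..1} x"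
        by eventually_elim (auto split: split_indicator)
    qed
    also have "\<dots> = Linf (emb ?u) * ennreal p"
      unfolding p(2)[symmetric] by (rule A_cmult) (simp add: indicator_M_plus)
    finally have 1: "A (emb ?u) \<le> Linf (emb ?u) * ennreal p" .
    have "A f \<le> ennreal C * (A (emb ?u) + A (emb ?v))"
      using C(2)[OF uv] A_split[OF f] by simp
    also have "\<dots> \<le> ennreal C * (ennreal (p + 1) * (Linf (emb ?u) + A (emb ?v)))"
    proof (rule mult_left_mono)
      have "A (emb ?u) + A (emb ?v) \<le> Linf (emb ?u) * ennreal (p + 1) + A (emb ?v) * ennreal (p + 1)"
      proof (rule add_mono)
        show "A (emb ?u) \<le> Linf (emb ?u) * ennreal (p + 1)"
          by (rule order_trans[OF 1 mult_left_mono]) (auto intro: ennreal_leI)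
        have "A (emb ?v) * 1 \<le> A (emb ?v) * ennreal (p + 1)"
          using p(1) by (intro mult_left_mono) auto
        then show "A (emb ?v) \<le> A (emb ?v) * ennreal (p + 1)" by simp
      qed
      then show "A (emb ?u) + A (emb ?v) \<le> ennreal (p + 1) * (Linf (emb ?u) + A (emb ?v))"
        by (simp add: distrib_left mult.commute)
    qed simp
    also have "\<dots> = ennreal (C * (p + 1)) * WL Linf A f"
      using C(1) p(1) by (simp add: WL_def ennreal_mult mult.assoc)
    finally show "A f \<le> ennreal (C * (p + 1)) * WL Linf A f" .
  qed (use C p in simp)
qed

text \<open>Beyond 1 the rearrangement is at most \<open>rearr f 1\<close>, which
  \<open>rearr_1_le\<close> bounds by \<open>A f\<close> divided by
  \<open>unit_norm\<close>.\<close>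

lemma embeds_WL_Linf: "A \<hookrightarrow> WL A Linf"
proof -
  obtain p where p: "0 < p" "unit_norm = ennreal p"
    using unit_norm_finite unit_norm_pos by (cases unit_norm) auto
  show ?thesis
  proof (rule embedsI[of "1 + 1 / p"])
    fix f assume f: "f \<in> M_all"
    let ?u = "\<lambda>t. rearr f t * indicator {0..1} t" and ?v = "\<lambda>t. rearr f t * indicator {1<..} t"
    have v: "?v \<in> borel_measurable halfline"
      using M_plus_mult_indicator[OF rearr_M_plus, of "{1<..}"] by (simp add: M_plus_def)
    have "Linf (emb ?v) \<le> rearr f 1"
      unfolding Linf_def fabs_emb
      by (rule esssup_I[OF v AE_I2]) (auto split: split_indicator intro: rearr_antimono)
    also have "rearr f 1 = rearr f 1 * unit_norm * ennreal (1 / p)"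
      using p by (simp add: mult.assoc ennreal_mult[symmetric])
    also have "\<dots> \<le> A f * ennreal (1 / p)"
      by (intro mult_right_mono order_trans[OF rearr_1_le A_restrict_le[OF f]]) auto
    finally have "Linf (emb ?v) \<le> A f * ennreal (1 / p)" .
    moreover have "A (emb ?u) \<le> A f"
      by (rule A_restrict_le[OF f]) simp
    ultimately have "WL A Linf f \<le> A f + A f * ennreal (1 / p)"
      unfolding WL_def by (rule add_mono[rotated])
    also have "\<dots> = ennreal (1 + 1 / p) * A f"
      using p by (simp add: distrib_left mult.commute)
    finally show "WL A Linf f \<le> ennreal (1 + 1 / p) * A f" .
  qed (use p in simp)
qed

section \<open>The embedding of \<open>WL A L1\<close> under the triangle inequality\<close>

text \<open>Finite sums are handled by induction, where a constant above 1 would accumulate; (P3)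
  then passes to the limit of the increasing partial sums.\<close>

lemma A_suminf_le:
  assumes P1: "prop_P1 A" and g: "\<And>n::nat. g n \<in> M_plus"
  shows "A (emb (\<lambda>x. \<Sum>n. g n x)) \<le> (\<Sum>n. A (emb (g n)))"
proof -
  have gs: "(\<lambda>x. \<Sum>i<n. g i x) \<in> M_plus" for n
    using g by (simp add: M_plus_def)
  have fin: "A (emb (\<lambda>x. \<Sum>i<n. g i x)) \<le> (\<Sum>i<n. A (emb (g i)))" for n
  proof (induction n)
    case 0
    \<comment> \<open>The zero function is written as a multiple by 0, so that homogeneity gives its
      norm.\<close>
    have "A (emb (\<lambda>x. 0 * 0)) = 0"
      by (subst A_cmult) (simp_all add: M_plus_def)
    then show ?case by simp
  next
    case (Suc n)
    have "A (emb (\<lambda>x. (\<Sum>i<n. g i x) + g n x)) \<le> A (emb (\<lambda>x. \<Sum>i<n. g i x)) + A (emb (g n))"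
      using P1 gs g by (simp add: prop_P1_def prop_Q1_def)
    also have "\<dots> \<le> (\<Sum>i<n. A (emb (g i))) + A (emb (g n))"
      by (intro add_right_mono Suc.IH)
    finally show ?case by simp
  qed
  have "(\<lambda>n. A (emb (\<lambda>x. \<Sum>i<n. g i x))) \<longlonglongrightarrow> A (emb (\<lambda>x. \<Sum>n. g n x))"
  proof (rule A_limit[OF gs])
    show "(\<lambda>x. \<Sum>n. g n x) \<in> M_plus" using g by (simp add: M_plus_def)
    show "(\<lambda>n. \<Sum>i<n. g i x) \<longlonglongrightarrow> (\<Sum>n. g n x)" for x
      by (rule summable_LIMSEQ) simp
    show "incseq (\<lambda>n. \<Sum>i<n. g i x)" for x
      by (rule incseq_SucI) simp
  qed
  moreover have "A (emb (\<lambda>x. \<Sum>i<n. g i x)) \<le> (\<Sum>n. A (emb (g n)))" for n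
    by (rule order_trans[OF fin sum_le_suminf]) auto
  ultimately show ?thesis
    by (intro LIMSEQ_le_const2) auto
qed

lemma suminf_indicator_unit_intervals:
  "(\<Sum>n. indicator {real n + 1<..real n + 2} x) = (indicator {1<..} x :: ennreal)"
proof -
  have "disjoint_family (\<lambda>n. {real n + 1<..real n + 2})"
    unfolding disjoint_family_on_def
  proof (intro ballI impI equals0I)
    fix m n :: nat and x
    assume "m \<noteq> n" "x \<in> {real m + 1<..real m + 2} \<inter> {real n + 1<..real n + 2}"
    then have "real m < real (Suc n)" "real n < real (Suc m)" by auto
    with \<open>m \<noteq> n\<close> show False by linarith
  qed
  moreover have "(\<Union>n. {real n + 1<..real n + 2}) = {1<..}"
  proof (intro equalityI subsetI)
    fix x :: real assume "x \<in> {1<..}"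
    \<comment> \<open>The index is forced by the right-closed intervals; \<open>x > 1\<close> makes
      the ceiling at least 2, so \<open>nat\<close> truncates nothing.\<close>
    then have "x \<in> {real (nat (\<lceil>x\<rceil> - 2)) + 1<..real (nat (\<lceil>x\<rceil> - 2)) + 2}"
      by (auto simp: of_nat_nat) linarith+
    then show "x \<in> (\<Union>n. {real n + 1<..real n + 2})" by blast
  qed auto
  ultimately show ?thesis
    by (simp add: suminf_indicator)
qed

lemma tail_le:
  assumes P1: "prop_P1 A"
  shows "A (emb (\<lambda>t. rearr f t * indicator {1<..} t)) \<le>
    unit_norm * (rearr f 1 + L1 (emb (\<lambda>t. rearr f t * indicator {1<..} t)))"
proof -
  let ?r = "rearr f" and ?\<chi> = "\<lambda>n::nat. indicator {real n + 1<..real n + 2} :: real \<Rightarrow> ennreal"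
  let ?v = "\<lambda>t. ?r t * indicator {1<..} t"
  have v: "?v t = (\<Sum>n. ?r t * ?\<chi> n t)" for t
    by (simp add: suminf_indicator_unit_intervals)
  have \<chi>: "?\<chi> n \<in> M_plus" for n by (rule indicator_M_plus) simp
  have c\<chi>: "(\<lambda>t. c * ?\<chi> n t) \<in> M_plus" for c n
    using \<chi>[of n] by (simp add: M_plus_def)
  \<comment> \<open>Upper step function: on each interval the rearrangement is bounded by its value
    at the left end point.\<close>
  have "A (emb ?v) \<le> A (emb (\<lambda>t. \<Sum>n. ?r (real n + 1) * ?\<chi> n t))"
  proof (rule A_mono)
    show "?v \<in> M_plus" by (simp add: M_plus_mult_indicator rearr_M_plus)
    show "(\<lambda>t. \<Sum>n. ?r (real n + 1) * ?\<chi> n t) \<in> M_plus"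
      using c\<chi> by (simp add: M_plus_def)
    show "AE t in halfline. ?v t \<le> (\<Sum>n. ?r (real n + 1) * ?\<chi> n t)"
      unfolding v by (intro AE_I2 suminf_le)
        (auto split: split_indicator intro: rearr_antimono)
  qed
  also have "\<dots> \<le> (\<Sum>n. A (emb (\<lambda>t. ?r (real n + 1) * ?\<chi> n t)))"
    by (rule A_suminf_le[OF P1 c\<chi>])
  also have "\<dots> = (\<Sum>n. unit_norm * ?r (real n + 1))"
  proof (rule suminf_cong)
    fix n
    show "A (emb (\<lambda>t. ?r (real n + 1) * ?\<chi> n t)) = unit_norm * ?r (real n + 1)"
      using unit_norm_translate[of "real n + 1"]
      by (subst A_cmult[OF \<chi>]) (simp add: mult.commute add.assoc)
  qed
  also have "\<dots> = unit_norm * (\<Sum>n. ?r (real n + 1))" by simp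
  \<comment> \<open>The value at 1 is split off, since the integral over
    \<open>(1, \<infinity>)\<close> does not control it. After the shift the heights are values at
    right end points, hence lower bounds on the same intervals.\<close>
  also have "(\<Sum>n. ?r (real n + 1)) = ?r 1 + (\<Sum>n. ?r (real n + 2))"
    using suminf_offset[of "\<lambda>n. ?r (real n + 1)" 1] by (simp add: add.commute add.left_commute)
  also have "(\<Sum>n. ?r (real n + 2)) = (\<Sum>n. \<integral>\<^sup>+t. ?r (real n + 2) * ?\<chi> n t \<partial>halfline)"
  proof (rule suminf_cong)
    fix n
    have "{real n + 1<..real n + 2} \<in> sets halfline"
      by (rule borel_imp_sets_halfline) auto
    moreover have "emeasure halfline {real n + 1<..real n + 2} = 1"
      by (subst emeasure_halfline_borel) auto
    ultimately show "?r (real n + 2) = (\<integral>\<^sup>+t. ?r (real n + 2) * ?\<chi> n t \<partial>halfline)"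
      by (subst nn_integral_cmult_indicator) auto
  qed
  also have "\<dots> = (\<integral>\<^sup>+t. (\<Sum>n. ?r (real n + 2) * ?\<chi> n t) \<partial>halfline)"
    using c\<chi> by (intro nn_integral_suminf[symmetric]) (simp add: M_plus_def)
  also have "\<dots> \<le> L1 (emb ?v)"
    unfolding L1_def fabs_emb v
    by (intro nn_integral_mono suminf_le) (auto split: split_indicator intro: rearr_antimono)
  finally show ?thesis by (simp add: mult_left_mono add_left_mono)
qed

lemma WL_L1_embeds:
  assumes P1: "prop_P1 A"
  shows "WL A L1 \<hookrightarrow> A"
proof -
  obtain p where p: "0 \<le> p" "unit_norm = ennreal p"
    using unit_norm_finite by (cases unit_norm) auto
  show ?thesis
  \<comment> \<open>The piece on \<open>[0, 1]\<close> counts twice, once for itself and once to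
    absorb the term with \<open>rearr f 1\<close>; \<open>p\<close> is the factor of the
    \<open>L1\<close> part.\<close>
  proof (rule embedsI[of "2 + p"])
    fix f assume f: "f \<in> M_all"
    let ?u = "\<lambda>t. rearr f t * indicator {0..1} t" and ?v = "\<lambda>t. rearr f t * indicator {1<..} t"
    have uv: "?u \<in> M_plus" "?v \<in> M_plus"
      by (simp_all add: M_plus_mult_indicator rearr_M_plus)
    have "A f \<le> A (emb ?u) + A (emb ?v)"
      unfolding A_split[OF f] using P1 uv by (simp add: prop_P1_def prop_Q1_def)
    also have "\<dots> \<le> A (emb ?u) + (rearr f 1 * unit_norm + unit_norm * L1 (emb ?v))"
      using tail_le[OF P1, of f] by (intro add_left_mono) (simp add: distrib_left mult.commute)
    also have "\<dots> \<le> A (emb ?u) + (A (emb ?u) + unit_norm * L1 (emb ?v))"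
      by (intro add_left_mono add_right_mono rearr_1_le)
    also have "\<dots> = 2 * A (emb ?u) + ennreal p * L1 (emb ?v)"
      by (simp add: p mult_2 add.assoc)
    also have "\<dots> \<le> ennreal (2 + p) * A (emb ?u) + ennreal (2 + p) * L1 (emb ?v)"
      using p by (intro add_mono mult_right_mono) auto
    also have "\<dots> = ennreal (2 + p) * WL A L1 f"
      by (simp add: WL_def distrib_left)
    finally show "A f \<le> ennreal (2 + p) * WL A L1 f" .
  qed (use p in simp)
qed

section \<open>Equivalence of (P5) with the embedding into \<open>WL L1 A\<close>\<close>

text \<open>(P5) is applied on \<open>[0, 1]\<close> to \<open>rearr f\<close>, which has the same
  norm as \<open>f\<close>; the tail costs one more \<open>A f\<close>.\<close>

lemma P5_imp_embeds_WL_L1: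
  assumes P5: "prop_P5 A"
  shows "A \<hookrightarrow> WL L1 A"
proof -
  have "{0..1} \<in> sets halfline" by (auto intro: borel_imp_sets_halfline)
  moreover have "emeasure halfline {0..1} < \<infinity>" by (simp add: emeasure_halfline_borel)
  ultimately obtain C where C: "0 \<le> C"
      "\<And>u. u \<in> M_plus \<Longrightarrow> (\<integral>\<^sup>+x\<in>{0..1}. u x \<partial>halfline) \<le> ennreal C * A (emb u)"
    using P5 unfolding prop_P5_def by blast
  show ?thesis
  proof (rule embedsI[of "C + 1"])
    fix f assume f: "f \<in> M_all"
    have "WL L1 A f \<le> ennreal C * A f + A f"
      unfolding WL_def L1_def fabs_emb
      using C(2)[OF rearr_M_plus, of f] A_restrict_le[OF f, of "{1<..}"]
      by (intro add_mono) (simp_all add: A_rearr[OF f])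
    also have "\<dots> = ennreal (C + 1) * A f"
      using C(1) by (simp add: distrib_right)
    finally show "WL L1 A f \<le> ennreal (C + 1) * A f" .
  qed (use C in simp)
qed

text \<open>On \<open>(1, n]\<close> the rearrangement is at most \<open>f\<^sup>*(1)\<close>, which is at most its mean over \<open>[0, 1]\<close>.\<close>

lemma set_nn_integral_rearr_le:
  "(\<integral>\<^sup>+t\<in>{0..real n}. rearr f t \<partial>halfline) \<le>
    of_nat (Suc n) * (\<integral>\<^sup>+t\<in>{0..1}. rearr f t \<partial>halfline)"
proof -
  let ?I = "\<integral>\<^sup>+t\<in>{0..1}. rearr f t \<partial>halfline"
  have S: "{0..1} \<in> sets halfline" "{0..real n} \<in> sets halfline"
    by (auto intro: borel_imp_sets_halfline)
  have "rearr f 1 = (\<integral>\<^sup>+t. rearr f 1 * indicator {0..1} t \<partial>halfline)"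
    using S by (subst nn_integral_cmult_indicator) (auto simp: emeasure_halfline_borel)
  also have "\<dots> \<le> ?I"
    by (intro nn_integral_mono) (auto split: split_indicator intro: rearr_antimono)
  finally have r1: "rearr f 1 \<le> ?I" .
  \<comment> \<open>The constant is added on all of \<open>[0, n]\<close>; the overlap with
    \<open>[0, 1]\<close> is slack, and it leads to the factor \<open>n + 1\<close> uniformly,
    including \<open>n = 0\<close>.\<close>
  have "(\<integral>\<^sup>+t\<in>{0..real n}. rearr f t \<partial>halfline) \<le>
      (\<integral>\<^sup>+t. rearr f t * indicator {0..1} t + rearr f 1 * indicator {0..real n} t \<partial>halfline)"
    by (intro nn_integral_mono) (auto split: split_indicator intro: rearr_antimono)
  also have "\<dots> = ?I + rearr f 1 * ennreal (real n)"
    using S by (subst nn_integral_add)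
      (auto simp: nn_integral_cmult_indicator emeasure_halfline_borel)
  also have "\<dots> \<le> ?I + ?I * ennreal (real n)"
    by (intro add_left_mono mult_right_mono r1) simp
  also have "\<dots> = of_nat (Suc n) * ?I"
    by (simp add: distrib_right mult.commute ennreal_of_nat_eq_real_of_nat)
  finally show ?thesis .
qed

text \<open>The integral over \<open>E\<close> is moved to an initial segment inside
  \<open>[0, n]\<close>, then reduced to \<open>[0, 1]\<close>, where it is the first summand of
  \<open>WL L1 A\<close>.\<close>

lemma embeds_WL_L1_imp_P5:
  assumes emb: "A \<hookrightarrow> WL L1 A"
  shows "prop_P5 A"
  unfolding prop_P5_def
proof (intro ballI impI)
  fix E assume E: "E \<in> sets halfline" and fin: "emeasure halfline E < \<infinity>"
  obtain K where K: "0 \<le> K" "\<And>f. f \<in> M_all \<Longrightarrow> A f < \<infinity> \<Longrightarrow> WL L1 A f \<le> ennreal K * A f"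
    using emb unfolding embeds_def fspace_def by auto
  obtain n :: nat where n: "emeasure halfline E < ennreal (real n)"
    using fin ennreal_Ex_less_of_nat by (auto simp: ennreal_of_nat_eq_real_of_nat)
  \<comment> \<open>The embedding speaks only of functions of finite norm. The summand 1 keeps the
    constant positive when \<open>K = 0\<close>, so that for infinite norm the right-hand side is
    infinite.\<close>
  let ?C = "real (Suc n) * K + 1"
  show "\<exists>C\<ge>0. \<forall>u\<in>M_plus. (\<integral>\<^sup>+x\<in>E. u x \<partial>halfline) \<le> ennreal C * A (emb u)"
  proof (intro exI[of _ ?C] conjI ballI)
    show "0 \<le> ?C" using K by simp
    fix u assume u: "u \<in> M_plus"
    then have f: "emb u \<in> M_all" by (rule emb_M_all)
    show "(\<integral>\<^sup>+x\<in>E. u x \<partial>halfline) \<le> ennreal ?C * A (emb u)"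
    proof (cases "A (emb u) < \<infinity>")
      case True
      have "(\<integral>\<^sup>+x\<in>E. u x \<partial>halfline) \<le>
          (\<integral>\<^sup>+t\<in>{t \<in> space halfline. ennreal t < emeasure halfline E}. rearr (emb u) t \<partial>halfline)"
        using u E by (intro set_nn_integral_le_rearr) (auto simp: M_plus_def)
      also have "\<dots> \<le> (\<integral>\<^sup>+t\<in>{0..real n}. rearr (emb u) t \<partial>halfline)"
      proof (intro nn_integral_mono mult_left_mono)
        fix t
        have "t \<le> real n" if "0 \<le> t" "ennreal t < emeasure halfline E"
          using less_trans[OF that(2) n] that(1) by (simp add: ennreal_less_iff)
        then show "indicator {t \<in> space halfline. ennreal t < emeasure halfline E} t \<le>
            (indicator {0..real n} t :: ennreal)"
          by (auto split: split_indicator)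
      qed simp
      also have "\<dots> \<le> of_nat (Suc n) * (\<integral>\<^sup>+t\<in>{0..1}. rearr (emb u) t \<partial>halfline)"
        by (rule set_nn_integral_rearr_le)
      also have "\<dots> \<le> of_nat (Suc n) * WL L1 A (emb u)"
        by (intro mult_left_mono) (simp_all add: WL_def L1_def)
      also have "\<dots> \<le> of_nat (Suc n) * (ennreal K * A (emb u))"
        by (intro mult_left_mono K f True) simp
      also have "\<dots> = ennreal (real (Suc n) * K) * A (emb u)"
        using K by (simp only: ennreal_of_nat_eq_real_of_nat ennreal_mult mult.assoc of_nat_0_le_iff)
      also have "\<dots> \<le> ennreal ?C * A (emb u)"
        by (intro mult_right_mono ennreal_leI) auto
      finally show ?thesis .
    next
      case False
      moreover have "0 < ?C" using K by (simp add: add_nonneg_pos)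
      ultimately show ?thesis
        by (simp add: less_top[symmetric] ennreal_mult_top)
    qed
  qed
qed

end

theorem theorem5p7:
  fixes A :: fnorm
  assumes "quasi_banach_norm A" and "rearrangement_invariant A"
  shows "(WL Linf A \<hookrightarrow> A) \<and>
         (prop_P1 A \<longrightarrow> (WL A L1 \<hookrightarrow> A)) \<and>
         ((A \<hookrightarrow> WL L1 A) \<longleftrightarrow> prop_P5 A) \<and>
         (A \<hookrightarrow> WL A Linf)"
proof -
  interpret ri_norm A using assms by unfold_locales
  show ?thesis
    using WL_Linf_embeds WL_L1_embeds P5_imp_embeds_WL_L1 embeds_WL_L1_imp_P5 embeds_WL_Linf
    by blast
qed

end
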